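(* For positive integers $m,n$ with $m>2n$, we have \[\rho(C_m,C_{2n})=\frac{2n}{m}.\]
   Context: $C_\ell$ denotes the cycle with $\ell$ edges; in the degenerate case $\ell=2$, $C_2$ is understood as the single edge $K_2$. A graphon is a symmetric measurable function $W:[0,1]^2\to[0,1]$. For a finite simple graph $G$ with vertices $v_1,\dots,v_n$, put $t(G,W)=\int_{[0,1]^n}\prod_{v_iv_j\in E(G)}W(x_i,x_j)\,dx_1\cdots dx_n$; for a finite graph $W$ (loops allowed), $t(G,W)=\hom(G,W)/|V(W)|^{|V(G)|}$, where $\hom(G,W)$ is the number of maps $V(G)\to V(W)$ sending edges to edges. For finite simple graphs $G,H$, the density domination exponent is $\rho(G,H)=\sup_W \frac{\log t(H,W)}{\log t(G,W)}\in[0,\infty]$, where $W$ ranges over all graphons (equivalently, all finite graphs) with $t(G,W)\ne 0$. Conventions: those $W$ with $t(G,W)=1$, where the quotient is undefined, are omitted; $\log 0=-\infty$, so the quotient is $+\infty$ if $t(H,W)=0$. Thus, when $G$ has at least one edge, for $c>0$ one has $\rho(G,H)\le c$ if and only if $t(H,W)\ge t(G,W)^c$ for every $W$. *)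

theory Defs
  imports "HOL-Analysis.Analysis" "Graph_Theory.Pair_Digraph"
begin

text \<open>
  A finite simple graph is a \<^locale>\<open>pair_graph\<close>: every edge \<open>{u, v}\<close> is present as the
  two arcs \<open>(u, v)\<close> and \<open>(v, u)\<close>.
\<close>

text \<open>For \<open>l = 2\<close> the two clauses give the same two arcs, so \<open>cycle_graph 2\<close> is the single
  edge; the definition is only meaningful for \<open>l \<ge> 2\<close>.\<close>

definition cycle_graph :: "nat \<Rightarrow> nat pair_pre_digraph" where
  "cycle_graph l =
     \<lparr> pverts = {..<l},
       parcs = {(i, j). i < l \<and> j < l \<and> (j = (i + 1) mod l \<or> i = (j + 1) mod l)} \<rparr>"

lemma pair_graph_cycle_graph:
  assumes "2 \<le> l"
  shows "pair_graph (cycle_graph l)"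
proof
  show "finite (pverts (cycle_graph l))"
    by (simp add: cycle_graph_def)
  have "parcs (cycle_graph l) \<subseteq> {..<l} \<times> {..<l}"
    by (auto simp: cycle_graph_def)
  then show "finite (parcs (cycle_graph l))"
    by (rule finite_subset) simp
  have neq: "Suc i mod l \<noteq> i" if "i < l" for i
    using assms that by (cases "Suc i = l") auto
  show "fst e \<noteq> snd e" if "e \<in> parcs (cycle_graph l)" for e
    using that by (auto simp: cycle_graph_def neq dest: sym)
  show "symmetric (with_proj (cycle_graph l))"
    unfolding symmetric_def by (rule symI) (auto simp: cycle_graph_def)
qed (auto simp: cycle_graph_def)

lemma parcs_cycle_graph_2: "parcs (cycle_graph 2) = {(0, 1), (1, 0)}"
  by (auto simp: cycle_graph_def less_2_cases_iff)

definition graphon :: "(real \<times> real \<Rightarrow> real) \<Rightarrow> bool" where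
  "graphon W \<longleftrightarrow>
     W \<in> borel_measurable (lebesgue_on ({0..1} \<times> {0..1})) \<and>
     (\<forall>x\<in>{0..1}. \<forall>y\<in>{0..1}. W (x, y) = W (y, x) \<and> 0 \<le> W (x, y) \<and> W (x, y) \<le> 1)"

text \<open>
  The measure is Lebesgue measure on the cube indexed by the vertices; it has to be completed
  because graphons are only assumed to be Lebesgue measurable. Restricting the product to arcs
  with \<open>u < v\<close> counts each edge once; by symmetry of \<open>W\<close> the choice of orientation is immaterial.
\<close>

definition hom_density :: "'a::linorder pair_pre_digraph \<Rightarrow> (real \<times> real \<Rightarrow> real) \<Rightarrow> real" where
  "hom_density G W =
     (LINT x | completion (Pi\<^sub>M (pverts G) (\<lambda>_. restrict_space lborel {0..1})).
        (\<Prod>(u, v)\<in>{(u, v). (u, v) \<in> parcs G \<and> u < v}. W (x u, x v)))"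

text \<open>
  The quotient of logarithms is \<open>\<infinity>\<close> if the numerator is \<open>log 0\<close>. Since densities lie in
  \<open>[0,1]\<close>, the real quotient is never negative, so \<^const>\<open>ennreal\<close> does not truncate.
\<close>

definition density_domination_exponent ::
    "'a::linorder pair_pre_digraph \<Rightarrow> 'b::linorder pair_pre_digraph \<Rightarrow> ennreal" where
  "density_domination_exponent G H =
     (SUP W \<in> {W. graphon W \<and> hom_density G W \<noteq> 0 \<and> hom_density G W \<noteq> 1}.
        if hom_density H W = 0 then \<infinity>
        else ennreal (ln (hom_density H W) / ln (hom_density G W)))"

end

theory Submission
  imports Defs
begin

text \<open>
  For the integral operator \<open>T\<close> with kernel \<open>W\<close>, the density of \<open>C\<^sub>l\<close> is the trace \<open>a l\<close> of \<open>T ^ l\<close>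
  (\<open>l \<ge> 3\<close>), so the upper bound is the monotonicity of Schatten norms. It is obtained without the
  spectral theorem: Cauchy-Schwarz gives \<open>(a (j + k))\<^sup>2 \<le> a (2 * j) * a (2 * k)\<close>, submultiplicativity of
  the Hilbert-Schmidt norm gives \<open>a (2 * (j + k)) \<le> a (2 * j) * a (2 * k)\<close>, and these two facts about
  the sequence \<open>a\<close> already imply the bound. Equality holds for the indicator of \<open>[0, 1/2]\<^sup>2\<close>,
  for which the density of \<open>C\<^sub>l\<close> is \<open>(1/2) ^ l\<close>.
\<close>

section \<open>Log-convex submultiplicative sequences\<close>

text \<open>
  The sequence \<open>a (2 * i) / c ^ i\<close> is log-convex, and it is at most 1 at all multiples of \<open>n\<close>,
  so it cannot increase anywhere beyond \<open>n\<close>: by log-convexity an increase would persist.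
\<close>

lemma log_convex_even_bound:
  fixes a :: "nat \<Rightarrow> real" and c :: real
  assumes nonneg: "\<And>l. 0 \<le> a l"
    and cs: "\<And>j k. 1 \<le> j \<Longrightarrow> 1 \<le> k \<Longrightarrow> (a (j + k))\<^sup>2 \<le> a (2 * j) * a (2 * k)"
    and submult: "\<And>j k. 1 \<le> j \<Longrightarrow> 1 \<le> k \<Longrightarrow> a (2 * (j + k)) \<le> a (2 * j) * a (2 * k)"
    and c: "0 \<le> c" "c ^ n = a (2 * n)"
    and n: "1 \<le> n" "n \<le> j"
  shows "a (2 * j) \<le> c ^ j"
\<comment> \<open>Dividing by \<open>c ^ i\<close> needs \<open>c > 0\<close>. For
  \<open>c = 0\<close>, Cauchy-Schwarz with indices \<open>i\<close> and \<open>i + 2\<close>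
  carries the zero of \<open>a (2 * i)\<close> on to \<open>a (2 * Suc i)\<close>.\<close>
proof (cases "c = 0")
  case True
  have "a (2 * i) = 0" if "n \<le> i" for i
    using that
  proof (induction i rule: dec_induct)
    case base
    show ?case using True c(2) n(1) by (simp add: power_0_left)
  next
    case (step i)
    have "(a (i + (i + 2)))\<^sup>2 \<le> a (2 * i) * a (2 * (i + 2))"
      using step(1) n(1) by (intro cs) auto
    moreover have "i + (i + 2) = 2 * Suc i" by simp
    ultimately have "(a (2 * Suc i))\<^sup>2 \<le> 0" using step.IH by (metis mult_zero_left)
    then show ?case by simp
  qed
  then show ?thesis using n True by simp
next
  case False
  with c(1) have c0: "0 < c" by simp
  define d where "d i = a (2 * i) / c ^ i" for i
  have d0: "0 \<le> d i" for i unfolding d_def using nonneg c0 by simp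
  have dn: "d n = 1" unfolding d_def using c(2)[symmetric] c0 by simp
  have dk: "d (n * Suc k) \<le> 1" for k
  proof (induction k)
    case 0
    show ?case using dn by simp
  next
    case (Suc k)
    have "a (2 * (n + n * Suc k)) \<le> a (2 * n) * a (2 * (n * Suc k))"
      using n by (intro submult) auto
    then have "d (n + n * Suc k) \<le> d n * d (n * Suc k)"
      using c0 unfolding d_def by (simp add: power_add divide_right_mono)
    then show ?case using Suc dn by simp
  qed
  have conv: "(d (Suc i))\<^sup>2 \<le> d i * d (Suc (Suc i))" if "1 \<le> i" for i
  proof -
    have "(a (i + Suc (Suc i)))\<^sup>2 \<le> a (2 * i) * a (2 * Suc (Suc i))"
      using that by (intro cs) auto
    moreover have "i + Suc (Suc i) = 2 * Suc i" by simp
    ultimately have "(a (2 * Suc i))\<^sup>2 \<le> a (2 * i) * a (2 * Suc (Suc i))" by metis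
    then have "(a (2 * Suc i))\<^sup>2 / (c ^ Suc i)\<^sup>2 \<le> a (2 * i) * a (2 * Suc (Suc i)) / (c ^ Suc i)\<^sup>2"
      using c0 by (intro divide_right_mono) auto
    then show ?thesis
      unfolding d_def by (simp add: power_divide power2_eq_square mult_ac)
  qed
  have increase_persists: "d (Suc i) < d (Suc (Suc i))" if "d i < d (Suc i)" "1 \<le> i" for i
  proof (rule ccontr)
    assume "\<not> ?thesis"
    then have "d i * d (Suc (Suc i)) \<le> d i * d (Suc i)"
      using d0 by (intro mult_left_mono) auto
    also have "\<dots> < d (Suc i) * d (Suc i)"
      using that d0[of i] by (intro mult_strict_right_mono) auto
    finally show False using conv[OF that(2)] by (simp add: power2_eq_square)
  qed
  have "d j \<le> 1"
  proof (rule ccontr)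
    assume gt: "\<not> d j \<le> 1"
    \<comment> \<open>Since \<open>d n = 1 < d j\<close>, some step between \<open>n\<close> and
      \<open>j\<close> must go up.\<close>
    have "\<exists>i\<ge>n. i < j \<and> d i < d (Suc i)"
    proof (rule ccontr)
      assume no: "\<not> ?thesis"
      have "d i \<le> 1" if "n \<le> i" "i \<le> j" for i
        using that
      proof (induction i rule: dec_induct)
        case base
        then show ?case using dn by simp
      next
        case (step i)
        then show ?case using no by (meson Suc_le_eq less_imp_le not_le order_trans)
      qed
      then show False using gt n(2) by blast
    qed
    then obtain i where i: "n \<le> i" "i < j" "d i < d (Suc i)" by blast
    have inc: "d l < d (Suc l)" if "i \<le> l" for l
      using that
    proof (induction l rule: dec_induct)
      case base
      then show ?case using i by simp
    next
      case (step l)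
      then show ?case using i n by (intro increase_persists) auto
    qed
    have mono: "d j \<le> d l" if "j \<le> l" for l
      using that
    proof (induction l rule: dec_induct)
      case (step l)
      then show ?case using inc[of l] i by simp
    qed simp
    \<comment> \<open>\<open>n * Suc j\<close> is a multiple of \<open>n\<close> beyond
      \<open>j\<close>, so \<open>d\<close> is at most 1 there.\<close>
    have "d j \<le> d (n * Suc j)"
      using n by (intro mono) (simp add: trans_le_add2)
    then show False using dk[of j] gt by simp
  qed
  then show ?thesis using c0 unfolding d_def by (simp add: divide_le_eq)
qed

text \<open>Splitting \<open>m\<close> into two halves, both at least \<open>n\<close>, lets
  Cauchy-Schwarz reduce odd indices to the even bound. As \<open>c\<close> is the
  \<open>n\<close>-th root of \<open>a (2 * n)\<close>, the squared form expresses the exponent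
  \<open>m / (2 * n)\<close> without real powers.\<close>

lemma log_convex_bound:
  fixes a :: "nat \<Rightarrow> real" and c :: real
  assumes nonneg: "\<And>l. 0 \<le> a l"
    and cs: "\<And>j k. 1 \<le> j \<Longrightarrow> 1 \<le> k \<Longrightarrow> (a (j + k))\<^sup>2 \<le> a (2 * j) * a (2 * k)"
    and submult: "\<And>j k. 1 \<le> j \<Longrightarrow> 1 \<le> k \<Longrightarrow> a (2 * (j + k)) \<le> a (2 * j) * a (2 * k)"
    and c: "0 \<le> c" "c ^ n = a (2 * n)"
    and n: "1 \<le> n" "2 * n \<le> m"
  shows "(a m)\<^sup>2 \<le> c ^ m"
proof -
  define j k where "j = m div 2" and "k = m - j"
  have jk: "m = j + k" "n \<le> j" "n \<le> k" using n unfolding j_def k_def by auto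
  have even: "a (2 * i) \<le> c ^ i" if "n \<le> i" for i
    by (rule log_convex_even_bound[OF nonneg cs submult c n(1) that])
  have "(a m)\<^sup>2 \<le> a (2 * j) * a (2 * k)"
    using cs[of j k] jk n by simp
  also have "\<dots> \<le> c ^ j * c ^ k"
    using even jk nonneg c by (intro mult_mono) auto
  finally show ?thesis using jk by (simp add: power_add)
qed

section \<open>Kernel powers and closed walks\<close>

text \<open>\<open>kernel_power M w k\<close> is the \<open>(k + 1)\<close>-st power of the integral operator with kernel \<open>w\<close>.\<close>

fun kernel_power :: "'a measure \<Rightarrow> ('a \<Rightarrow> 'a \<Rightarrow> ennreal) \<Rightarrow> nat \<Rightarrow> 'a \<Rightarrow> 'a \<Rightarrow> ennreal" where
  "kernel_power M w 0 x y = w x y"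
| "kernel_power M w (Suc k) x y = (\<integral>\<^sup>+z. kernel_power M w k x z * w z y \<partial>M)"

text \<open>The Hilbert-Schmidt inner product of the operator powers \<open>j + 1\<close> and
  \<open>k + 1\<close>; for symmetric \<open>w\<close> it is the trace of the power
  \<open>j + k + 2\<close>.\<close>

definition kernel_pairing :: "'a measure \<Rightarrow> ('a \<Rightarrow> 'a \<Rightarrow> ennreal) \<Rightarrow> nat \<Rightarrow> nat \<Rightarrow> ennreal" where
  "kernel_pairing M w j k =
     (\<integral>\<^sup>+x. \<integral>\<^sup>+y. kernel_power M w j x y * kernel_power M w k x y \<partial>M \<partial>M)"

text \<open>Used to keep closed-walk integrals finite, so that \<open>enn2real\<close> loses nothing
  on them.\<close>

lemma kernel_power_le_1:
  assumes "\<And>x y. w x y \<le> 1" "emeasure M (space M) \<le> 1"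
  shows "kernel_power M w k x y \<le> 1"
proof (induction k arbitrary: x y)
  case (Suc k)
  have "kernel_power M w (Suc k) x y \<le> (\<integral>\<^sup>+z. 1 \<partial>M)"
    unfolding kernel_power.simps using Suc assms(1)
    by (intro nn_integral_mono) (metis mult_mono mult_1 zero_le)
  then show ?case using assms(2) by (simp add: order_trans)
qed (use assms in simp)

lemma nn_integral_square_le_1:
  assumes "\<And>x y. f x y \<le> (1::ennreal)" "emeasure M (space M) \<le> 1"
  shows "(\<integral>\<^sup>+x. \<integral>\<^sup>+y. f x y \<partial>M \<partial>M) \<le> 1"
proof -
  have *: "(\<integral>\<^sup>+x. g x \<partial>M) \<le> 1" if "\<And>x. g x \<le> (1::ennreal)" for g
  proof -
    have "(\<integral>\<^sup>+x. g x \<partial>M) \<le> (\<integral>\<^sup>+x. 1 \<partial>M)" by (intro nn_integral_mono that)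
    then show ?thesis using assms(2) by (simp add: order_trans)
  qed
  show ?thesis by (intro * assms)
qed

text \<open>Values in \<open>ennreal\<close> allow Tonelli's theorem to exchange integrals without
  integrability conditions.\<close>

locale symmetric_kernel = sigma_finite_measure M for M :: "'a measure" +
  fixes w :: "'a \<Rightarrow> 'a \<Rightarrow> ennreal"
  assumes measurable_kernel[measurable]: "case_prod w \<in> borel_measurable (M \<Otimes>\<^sub>M M)"
    and sym_kernel: "w x y = w y x"
begin

sublocale pair: pair_sigma_finite M M ..

lemma measurable_kernel_power[measurable]:
  "case_prod (kernel_power M w k) \<in> borel_measurable (M \<Otimes>\<^sub>M M)"
proof (induction k)
  case (Suc k)
  note [measurable] = Suc
  show ?case by simp
qed simp

text \<open>Associativity of composition, by Tonelli. The \<open>Suc\<close> appears because index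
  \<open>k\<close> stands for the power \<open>k + 1\<close>.\<close>

lemma kernel_power_add:
  assumes "x \<in> space M" "y \<in> space M"
  shows "kernel_power M w (Suc (j + k)) x y = (\<integral>\<^sup>+z. kernel_power M w j x z * kernel_power M w k z y \<partial>M)"
  using assms(2)
proof (induction k arbitrary: y)
  case (Suc k)
  note [measurable] = assms(1) Suc(2)
  have "kernel_power M w (Suc (j + Suc k)) x y = (\<integral>\<^sup>+u. \<integral>\<^sup>+z. kernel_power M w j x z * kernel_power M w k z u * w u y \<partial>M \<partial>M)"
    using Suc by (auto simp: nn_integral_multc simp del: kernel_power.simps(2) intro!: nn_integral_cong
      simp: kernel_power.simps(2)[of _ _ "Suc (j + k)"])
  also have "\<dots> = (\<integral>\<^sup>+z. \<integral>\<^sup>+u. kernel_power M w j x z * kernel_power M w k z u * w u y \<partial>M \<partial>M)"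
    by (rule pair.Fubini') simp
  also have "\<dots> = (\<integral>\<^sup>+z. kernel_power M w j x z * kernel_power M w (Suc k) z y \<partial>M)"
    by (auto simp: nn_integral_cmult mult.assoc intro!: nn_integral_cong)
  finally show ?case .
qed simp

text \<open>Self-adjointness: by symmetry of \<open>w\<close>, one factor of the operator moves to
  the other side of the inner product.\<close>

lemma kernel_pairing_shift: "kernel_pairing M w (Suc j) k = kernel_pairing M w j (Suc k)"
proof -
  have "(\<integral>\<^sup>+y. kernel_power M w (Suc j) x y * kernel_power M w k x y \<partial>M)
      = (\<integral>\<^sup>+y. kernel_power M w j x y * kernel_power M w (Suc k) x y \<partial>M)" if [measurable]: "x \<in> space M" for x
  proof -
    have "(\<integral>\<^sup>+y. kernel_power M w (Suc j) x y * kernel_power M w k x y \<partial>M)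
       = (\<integral>\<^sup>+y. \<integral>\<^sup>+z. kernel_power M w j x z * w z y * kernel_power M w k x y \<partial>M \<partial>M)"
      by (auto simp: nn_integral_multc intro!: nn_integral_cong)
    also have "\<dots> = (\<integral>\<^sup>+z. \<integral>\<^sup>+y. kernel_power M w j x z * w z y * kernel_power M w k x y \<partial>M \<partial>M)"
      by (rule pair.Fubini') simp
    also have "\<dots> = (\<integral>\<^sup>+z. \<integral>\<^sup>+y. kernel_power M w j x z * (kernel_power M w k x y * w y z) \<partial>M \<partial>M)"
      by (simp add: sym_kernel mult_ac)
    also have "\<dots> = (\<integral>\<^sup>+z. kernel_power M w j x z * kernel_power M w (Suc k) x z \<partial>M)"
      by (auto simp: nn_integral_cmult intro!: nn_integral_cong)
    finally show ?thesis .
  qed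
  then show ?thesis unfolding kernel_pairing_def by (rule nn_integral_cong)
qed

text \<open>The closed walk of length \<open>j + k + 2\<close> may be cut open at any vertex.\<close>

lemma kernel_pairing_eq: "kernel_pairing M w j k = kernel_pairing M w 0 (j + k)"
  by (induction j arbitrary: k) (auto simp: kernel_pairing_shift simp del: kernel_power.simps)

lemma kernel_pairing_Cauchy_Schwarz:
  "(kernel_pairing M w j k)\<^sup>2 \<le> kernel_pairing M w j j * kernel_pairing M w k k"
proof -
  let ?f = "\<lambda>i p. kernel_power M w i (fst p) (snd p)"
  \<comment> \<open>Kernels are treated as functions on the product space, where the pairing is the
    L2 inner product.\<close>
  have *: "kernel_pairing M w i l = (\<integral>\<^sup>+p. ?f i p * ?f l p \<partial>(M \<Otimes>\<^sub>M M))" for i l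
    unfolding kernel_pairing_def
    by (subst nn_integral_fst[symmetric]) (auto simp: case_prod_unfold)
  show ?thesis
    unfolding * power2_eq_square[of "?f _ _", symmetric]
    by (rule Cauchy_Schwarz_nn_integral) auto
qed

text \<open>Cauchy-Schwarz in the intermediate vertex \<open>z\<close> bounds the squared kernel of
  a composition by a function of \<open>x\<close> times a function of \<open>y\<close>, so the
  double integral factors.\<close>

lemma kernel_pairing_submult:
  "kernel_pairing M w (Suc (j + k)) (Suc (j + k)) \<le> kernel_pairing M w j j * kernel_pairing M w k k"
proof -
  let ?K = "kernel_power M w"
  have "kernel_pairing M w (Suc (j + k)) (Suc (j + k)) = (\<integral>\<^sup>+x. \<integral>\<^sup>+y. (\<integral>\<^sup>+z. ?K j x z * ?K k z y \<partial>M)\<^sup>2 \<partial>M \<partial>M)"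
    unfolding kernel_pairing_def power2_eq_square
    by (auto intro!: nn_integral_cong simp: kernel_power_add simp del: kernel_power.simps)
  also have "\<dots> \<le> (\<integral>\<^sup>+x. \<integral>\<^sup>+y. (\<integral>\<^sup>+z. (?K j x z)\<^sup>2 \<partial>M) * (\<integral>\<^sup>+z. (?K k z y)\<^sup>2 \<partial>M) \<partial>M \<partial>M)"
    by (intro nn_integral_mono Cauchy_Schwarz_nn_integral) auto
  also have "\<dots> = (\<integral>\<^sup>+x. (\<integral>\<^sup>+z. (?K j x z)\<^sup>2 \<partial>M) \<partial>M) * (\<integral>\<^sup>+y. \<integral>\<^sup>+z. (?K k z y)\<^sup>2 \<partial>M \<partial>M)"
    by (simp add: nn_integral_cmult nn_integral_multc)
  also have "(\<integral>\<^sup>+y. \<integral>\<^sup>+z. (?K k z y)\<^sup>2 \<partial>M \<partial>M) = (\<integral>\<^sup>+z. \<integral>\<^sup>+y. (?K k z y)\<^sup>2 \<partial>M \<partial>M)"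
    by (rule pair.Fubini') simp
  finally show ?thesis
    unfolding kernel_pairing_def power2_eq_square .
qed

text \<open>All inner vertices of a path are integrated out. The weight \<open>g\<close> on the
  endpoints later closes the path to a cycle, or is 1 for the single edge.\<close>

lemma nn_integral_walk:
  fixes g :: "'a \<Rightarrow> 'a \<Rightarrow> ennreal"
  assumes "case_prod g \<in> borel_measurable (M \<Otimes>\<^sub>M M)"
  shows "(\<integral>\<^sup>+x. (\<Prod>i\<le>k. w (x i) (x (Suc i))) * g (x 0) (x (Suc k)) \<partial>(Pi\<^sub>M {..Suc k} (\<lambda>_. M)))
    = (\<integral>\<^sup>+x. \<integral>\<^sup>+y. kernel_power M w k x y * g x y \<partial>M \<partial>M)"
  using assms
proof (induction k arbitrary: g)
  case 0
  note [measurable] = 0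
  interpret product_sigma_finite "\<lambda>_::nat. M" ..
  have *: "{..Suc 0} = {0, Suc 0}" by auto
  show ?case
    unfolding * using product_nn_integral_pair[of "\<lambda>x y. w x y * g x y" 0 "Suc 0"]
    by (simp add: nn_integral_fst[symmetric] case_prod_unfold)
next
  case (Suc k)
  note [measurable] = Suc(2)
  interpret product_sigma_finite "\<lambda>_::nat. M" ..
  let ?P = "\<lambda>x. \<Prod>i\<le>k. w (x i) (x (Suc i))"
  \<comment> \<open>The last edge is absorbed into the endpoint weight, which is why the induction
    needs arbitrary \<open>g\<close>.\<close>
  let ?g = "\<lambda>x y. \<integral>\<^sup>+z. w y z * g x z \<partial>M"
  have [measurable]: "?P \<in> borel_measurable (Pi\<^sub>M {..Suc k} (\<lambda>_. M))"
    by (intro borel_measurable_prod_ennreal) measurable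
  have meas: "(\<lambda>x. (\<Prod>i\<le>Suc k. w (x i) (x (Suc i))) * g (x 0) (x (Suc (Suc k))))
      \<in> borel_measurable (Pi\<^sub>M {..Suc (Suc k)} (\<lambda>_. M))"
    by (intro borel_measurable_times_ennreal borel_measurable_prod_ennreal) measurable
  have "(\<integral>\<^sup>+x. (\<Prod>i\<le>Suc k. w (x i) (x (Suc i))) * g (x 0) (x (Suc (Suc k))) \<partial>(Pi\<^sub>M {..Suc (Suc k)} (\<lambda>_. M)))
     = (\<integral>\<^sup>+x. \<integral>\<^sup>+z. ?P x * (w (x (Suc k)) z * g (x 0) z) \<partial>M \<partial>(Pi\<^sub>M {..Suc k} (\<lambda>_. M)))"
    unfolding atMost_Suc[of "Suc k"]
    by (subst product_nn_integral_insert[OF _ _ meas[unfolded atMost_Suc[of "Suc k"]]])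
      (auto intro!: nn_integral_cong prod.cong simp: mult_ac)
  also have "\<dots> = (\<integral>\<^sup>+x. ?P x * ?g (x 0) (x (Suc k)) \<partial>(Pi\<^sub>M {..Suc k} (\<lambda>_. M)))"
  proof (intro nn_integral_cong nn_integral_cmult)
    fix x assume "x \<in> space (Pi\<^sub>M {..Suc k} (\<lambda>_. M))"
    then have [measurable]: "x 0 \<in> space M" "x (Suc k) \<in> space M"
      by (auto simp: space_PiM PiE_iff)
    show "(\<lambda>z. w (x (Suc k)) z * g (x 0) z) \<in> borel_measurable M" by measurable
  qed
  also have "\<dots> = (\<integral>\<^sup>+x. \<integral>\<^sup>+y. kernel_power M w k x y * ?g x y \<partial>M \<partial>M)"
    by (rule Suc.IH) measurable
  also have "\<dots> = (\<integral>\<^sup>+x. \<integral>\<^sup>+y. \<integral>\<^sup>+z. kernel_power M w k x y * w y z * g x z \<partial>M \<partial>M \<partial>M)"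
    by (auto intro!: nn_integral_cong simp: nn_integral_cmult[symmetric] mult.assoc)
  also have "\<dots> = (\<integral>\<^sup>+x. \<integral>\<^sup>+z. \<integral>\<^sup>+y. kernel_power M w k x y * w y z * g x z \<partial>M \<partial>M \<partial>M)"
    by (intro nn_integral_cong pair.Fubini') measurable
  also have "\<dots> = (\<integral>\<^sup>+x. \<integral>\<^sup>+z. kernel_power M w (Suc k) x z * g x z \<partial>M \<partial>M)"
    by (auto intro!: nn_integral_cong simp: nn_integral_multc)
  finally show ?case .
qed

end

section \<open>Homomorphism densities of cycles\<close>

text \<open>By Tonelli the coordinates \<open>u\<close> and \<open>v\<close> can be integrated
  innermost, where the exceptional null set contributes 0 whatever the other coordinates
  are.\<close>

lemma AE_PiM_pair:
  assumes "product_sigma_finite M" "finite I" "u \<in> I" "v \<in> I" "u \<noteq> v"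
    and ae: "AE p in M u \<Otimes>\<^sub>M M v. P p"
  shows "AE x in Pi\<^sub>M I M. P (x u, x v)"
proof -
  interpret product_sigma_finite M by fact
  interpret pair: pair_sigma_finite "M u" "M v" ..
  obtain N where N: "{p \<in> space (M u \<Otimes>\<^sub>M M v). \<not> P p} \<subseteq> N" "emeasure (M u \<Otimes>\<^sub>M M v) N = 0"
      and [measurable]: "N \<in> sets (M u \<Otimes>\<^sub>M M v)"
    using ae by (rule AE_E)
  define J where "J = I - {u, v}"
  have I: "I = insert u (insert v J)" and J: "finite J" "v \<notin> J" "u \<notin> insert v J"
    using assms unfolding J_def by auto
  have [measurable]: "(\<lambda>x. indicator N (x u, x v) :: ennreal) \<in> borel_measurable (Pi\<^sub>M I M)"
    using assms(3,4) by measurable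
  have [measurable]: "(\<lambda>x. indicator N (a, x v) :: ennreal) \<in> borel_measurable (Pi\<^sub>M (insert v J) M)"
    if [measurable]: "a \<in> space (M u)" for a
    by measurable
  have "(\<integral>\<^sup>+x. indicator N (x u, x v) \<partial>Pi\<^sub>M I M)
      = (\<integral>\<^sup>+a. \<integral>\<^sup>+x. indicator N (a, x v) \<partial>Pi\<^sub>M (insert v J) M \<partial>M u)"
    unfolding I using J assms by (subst product_nn_integral_insert_rev) (auto simp: I[symmetric])
  also have "\<dots> = (\<integral>\<^sup>+a. \<integral>\<^sup>+x. \<integral>\<^sup>+b. indicator N (a, b) \<partial>M v \<partial>Pi\<^sub>M J M \<partial>M u)"
    using J by (intro nn_integral_cong, subst product_nn_integral_insert) auto
  also have "\<dots> = (\<integral>\<^sup>+x. \<integral>\<^sup>+a. \<integral>\<^sup>+b. indicator N (a, b) \<partial>M v \<partial>M u \<partial>Pi\<^sub>M J M)"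
  proof -
    interpret J: finite_product_sigma_finite M J by standard fact
    interpret Q: pair_sigma_finite "Pi\<^sub>M J M" "M u" ..
    show ?thesis by (rule Q.Fubini') measurable
  qed
  also have "\<dots> = 0"
    using N(2) by (simp add: M.emeasure_pair_measure)
  finally have "AE x in Pi\<^sub>M I M. (indicator N (x u, x v) :: ennreal) = 0"
    by (subst (asm) nn_integral_0_iff_AE) auto
  moreover have "AE x in Pi\<^sub>M I M. (x u, x v) \<in> space (M u \<Otimes>\<^sub>M M v)"
    using assms by (intro AE_I2) (auto simp: space_pair_measure space_PiM PiE_iff)
  ultimately show ?thesis
    by eventually_elim (use N(1) in \<open>auto simp: indicator_def split: if_splits\<close>)
qed

text \<open>Products of values of a graphon are in general not Borel on the cube; agreeing almost
  everywhere with a Borel function makes them measurable for the completed measure.\<close>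

lemma borel_measurable_completion_AE_cong:
  fixes f g :: "'a \<Rightarrow> 'b::topological_space"
  assumes g[measurable]: "g \<in> borel_measurable M" and ae: "AE x in M. f x = g x"
  shows "f \<in> borel_measurable (completion M)"
proof (rule measurableI)
  fix A :: "'b set" assume [measurable]: "A \<in> sets borel"
  show "f -` A \<inter> space (completion M) \<in> sets (completion M)"
  proof (rule completion.in_sets_AE)
    show "AE x in completion M. x \<in> g -` A \<inter> space M \<longleftrightarrow> x \<in> f -` A \<inter> space (completion M)"
      using AE_completion[OF ae] by eventually_elim auto
  qed auto
qed auto

section \<open>Borel versions of graphons\<close>

abbreviation unit_interval_measure :: "real measure" where
  "unit_interval_measure \<equiv> restrict_space lborel {0..1}"

lemma emeasure_unit_interval_measure: "emeasure unit_interval_measure (space unit_interval_measure) = 1"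
  by (simp add: emeasure_restrict_space space_restrict_space)

interpretation unit_interval: sigma_finite_measure unit_interval_measure
  by (rule sigma_finite_measure_restrict_space) (auto intro: lborel.sigma_finite_measure_axioms)

interpretation unit_square: pair_sigma_finite unit_interval_measure unit_interval_measure ..

interpretation unit_cube: product_sigma_finite "\<lambda>_. unit_interval_measure" ..

text \<open>Symmetry and bounds are imposed at all reals, to match the unconditional symmetry in
  \<open>symmetric_kernel\<close>.\<close>

definition symmetric_unit_kernel :: "(real \<Rightarrow> real \<Rightarrow> real) \<Rightarrow> bool" where
  "symmetric_unit_kernel w \<longleftrightarrow>
     case_prod w \<in> borel_measurable (unit_interval_measure \<Otimes>\<^sub>M unit_interval_measure) \<and>
     (\<forall>x y. w x y = w y x \<and> 0 \<le> w x y \<and> w x y \<le> 1)"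

text \<open>Kernel composition requires measurability for the product sigma-algebra, while a graphon
  is only Lebesgue measurable. A Borel version is symmetrized and clipped, and still agrees with the
  graphon almost everywhere.\<close>

lemma graphon_borel_version:
  assumes "graphon W"
  obtains w where "symmetric_unit_kernel w"
    "AE p in unit_interval_measure \<Otimes>\<^sub>M unit_interval_measure. W p = w (fst p) (snd p)"
proof -
  let ?U = "unit_interval_measure" and ?S = "{0..1::real} \<times> {0..1::real}"
  have S: "?S \<in> sets lebesgue"
    using borel_closed[OF closed_Times[OF closed_atLeastAtMost closed_atLeastAtMost]]
    by (intro sets_completionI_sets) simp
  have "(\<lambda>p. if p \<in> ?S then W p else 0) \<in> borel_measurable lebesgue"
    using assms unfolding graphon_def borel_measurable_if[OF S] by simp
  from completion_ex_borel_measurable_real[OF this] obtain g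
    where g: "g \<in> borel_measurable lborel" and ae: "AE p in lborel. (if p \<in> ?S then W p else 0) = g p"
    by blast
  have [measurable]: "g \<in> borel_measurable (borel \<Otimes>\<^sub>M borel)"
    using g by (simp add: borel_prod)
  have [measurable]: "(\<lambda>x. x) \<in> ?U \<rightarrow>\<^sub>M borel"
    by (rule measurable_restrict_space1) simp
  obtain N where N: "{p \<in> space lborel. \<not> ((if p \<in> ?S then W p else 0) = g p)} \<subseteq> N"
      "emeasure lborel N = 0" "N \<in> sets lborel"
    using ae by (rule AE_E)
  have [measurable]: "N \<in> sets (borel \<Otimes>\<^sub>M borel)"
    using N(3) unfolding borel_prod by simp
  have space: "p \<in> ?S" if "p \<in> space (?U \<Otimes>\<^sub>M ?U)" for p
    using that by (auto simp: space_pair_measure space_restrict_space)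
  \<comment> \<open>Sections carry the null set from the plane to the product of the restricted
    measures.\<close>
  have "AE p in lborel \<Otimes>\<^sub>M lborel. p \<notin> N"
    unfolding lborel_prod using N by (intro AE_not_in) auto
  then have "AE x in lborel. AE y in lborel. (x, y) \<notin> N"
    by (rule lborel_pair.AE_pair)
  then have "AE x in ?U. AE y in ?U. (x, y) \<notin> N"
    by (auto simp: AE_restrict_space_iff elim!: eventually_mono)
  moreover have "Measurable.pred (?U \<Otimes>\<^sub>M ?U) (\<lambda>p. (fst p, snd p) \<notin> N)"
    by measurable
  ultimately have "AE p in ?U \<Otimes>\<^sub>M ?U. p \<notin> N"
    by (intro unit_square.AE_pair_measure) (auto simp: pred_def)
  then have Wg: "AE p in ?U \<Otimes>\<^sub>M ?U. W p = g p"
    using AE_space by eventually_elim (use N(1) space in \<open>fastforce split: if_splits\<close>)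
  \<comment> \<open>The flip preserves the product measure, so the mirrored values agree almost
    everywhere too.\<close>
  have "AE p in distr (?U \<Otimes>\<^sub>M ?U) (?U \<Otimes>\<^sub>M ?U) (\<lambda>(x, y). (y, x)). W p = g p"
    using Wg unfolding unit_square.distr_pair_swap[symmetric] .
  from AE_distrD[OF measurable_pair_swap' this]
  have Wg': "AE p in ?U \<Otimes>\<^sub>M ?U. W (snd p, fst p) = g (snd p, fst p)"
    by (simp add: case_prod_unfold)
  \<comment> \<open>The maximum forces symmetry and the clipping forces the bounds at every point.
    Where both values of \<open>g\<close> are those of \<open>W\<close>, nothing changes.\<close>
  define w where "w x y = max 0 (min 1 (max (g (x, y)) (g (y, x))))" for x y
  show ?thesis
  proof
    show "symmetric_unit_kernel w"
      unfolding symmetric_unit_kernel_def w_def by (auto simp: max.commute)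
    show "AE p in ?U \<Otimes>\<^sub>M ?U. W p = w (fst p) (snd p)"
      using Wg Wg' AE_space
    proof eventually_elim
      case (elim p)
      obtain x y where p: "p = (x, y)" by (cases p)
      show ?case
        using elim space[of p] assms unfolding graphon_def p w_def by fastforce
    qed
  qed
qed

text \<open>Each of the finitely many arcs contributes one null set of the cube, so \<open>W\<close>
  may be replaced by \<open>w\<close> and the completion dropped.\<close>

lemma hom_density_eq_nn_integral:
  assumes G: "finite (pverts G)" "parcs G \<subseteq> pverts G \<times> pverts G"
    and w: "symmetric_unit_kernel w"
    and W: "AE p in unit_interval_measure \<Otimes>\<^sub>M unit_interval_measure. W p = w (fst p) (snd p)"
  shows "hom_density G W = enn2real (\<integral>\<^sup>+x.
      (\<Prod>(u, v)\<in>{(u, v). (u, v) \<in> parcs G \<and> u < v}. ennreal (w (x u) (x v)))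
      \<partial>Pi\<^sub>M (pverts G) (\<lambda>_. unit_interval_measure))"
proof -
  let ?P = "Pi\<^sub>M (pverts G) (\<lambda>_. unit_interval_measure)"
  define E where "E = {(u, v). (u, v) \<in> parcs G \<and> u < v}"
  have E: "u \<in> pverts G" "v \<in> pverts G" "u \<noteq> v" if "(u, v) \<in> E" for u v
    using that G unfolding E_def by auto
  have "E \<subseteq> pverts G \<times> pverts G" using E by auto
  then have finE: "finite E" using G(1) finite_subset by blast
  have [measurable]: "case_prod w \<in> borel_measurable (unit_interval_measure \<Otimes>\<^sub>M unit_interval_measure)"
    and w0: "0 \<le> w x y" for x y
    using w unfolding symmetric_unit_kernel_def by auto
  have meas: "(\<lambda>x. \<Prod>(u, v)\<in>E. w (x u) (x v)) \<in> borel_measurable ?P"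
    unfolding case_prod_unfold using E
    by (intro borel_measurable_prod) (auto, measurable)
  have "AE x in ?P. \<forall>e\<in>E. W (x (fst e), x (snd e)) = w (x (fst e)) (x (snd e))"
  proof (rule AE_finite_allI[OF finE])
    fix e assume "e \<in> E"
    then show "AE x in ?P. W (x (fst e), x (snd e)) = w (x (fst e)) (x (snd e))"
      using AE_PiM_pair[OF unit_cube.product_sigma_finite_axioms G(1) _ _ _ W, of "fst e" "snd e"] E
      by (cases e) auto
  qed
  then have ae: "AE x in ?P. (\<Prod>(u, v)\<in>E. W (x u, x v)) = (\<Prod>(u, v)\<in>E. w (x u) (x v))"
    by eventually_elim (auto intro!: prod.cong)
  have "hom_density G W = (LINT x|completion ?P. (\<Prod>(u, v)\<in>E. w (x u) (x v)))"
    unfolding hom_density_def E_def[symmetric]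
    using borel_measurable_completion_AE_cong[OF meas ae] measurable_completion[OF meas] AE_completion[OF ae]
    by (rule integral_cong_AE)
  also have "\<dots> = (LINT x|?P. (\<Prod>(u, v)\<in>E. w (x u) (x v)))"
    by (rule integral_completion[OF meas])
  also have "\<dots> = enn2real (\<integral>\<^sup>+x. ennreal (\<Prod>(u, v)\<in>E. w (x u) (x v)) \<partial>?P)"
    using w0 by (intro integral_eq_nn_integral meas AE_I2) (auto intro!: prod_nonneg)
  also have "\<dots> = enn2real (\<integral>\<^sup>+x. (\<Prod>(u, v)\<in>E. ennreal (w (x u) (x v))) \<partial>?P)"
    using w0 by (simp add: prod_ennreal case_prod_unfold)
  finally show ?thesis unfolding E_def .
qed

section \<open>Cycle densities as walk integrals\<close>

text \<open>A path plus the closing arc, which points away from 0 because of \<open>u < v\<close>.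
  For \<open>k = 0\<close> the closing arc is already the path arc.\<close>

lemma cycle_graph_increasing_arcs:
  "{(u, v). (u, v) \<in> parcs (cycle_graph (Suc (Suc k))) \<and> u < v}
     = insert (0, Suc k) ((\<lambda>i. (i, Suc i)) ` {..k})"
proof -
  have mod: "Suc b mod Suc (Suc k) = (if b = Suc k then 0 else Suc b)" if "b < Suc (Suc k)" for b
    using that by auto
  show ?thesis
    by (auto simp: cycle_graph_def image_iff mod split: if_splits)
qed

text \<open>This is the path-times-endpoint-weight form that \<open>nn_integral_walk\<close>
  evaluates. The conditional prevents the only edge of the degenerate cycle from being counted
  twice.\<close>

lemma hom_density_cycle_graph:
  assumes w: "symmetric_unit_kernel w"
    and W: "AE p in unit_interval_measure \<Otimes>\<^sub>M unit_interval_measure. W p = w (fst p) (snd p)"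
  shows "hom_density (cycle_graph (Suc (Suc k))) W = enn2real (\<integral>\<^sup>+x.
      (\<Prod>i\<le>k. ennreal (w (x i) (x (Suc i)))) * (if k = 0 then 1 else ennreal (w (x 0) (x (Suc k))))
      \<partial>Pi\<^sub>M {..Suc k} (\<lambda>_. unit_interval_measure))"
proof -
  have prod: "(\<Prod>(u, v)\<in>insert (0, Suc k) ((\<lambda>i. (i, Suc i)) ` {..k}). f u v)
      = (\<Prod>i\<le>k. f i (Suc i)) * (if k = 0 then 1 else f 0 (Suc k))" for f :: "nat \<Rightarrow> nat \<Rightarrow> ennreal"
  proof -
    have "(\<Prod>(u, v)\<in>(\<lambda>i. (i, Suc i)) ` {..k}. f u v) = (\<Prod>i\<le>k. f i (Suc i))"
      by (subst prod.reindex) (auto simp: inj_on_def)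
    moreover have "(0, Suc k) \<in> (\<lambda>i. (i, Suc i)) ` {..k} \<longleftrightarrow> k = 0" by auto
    ultimately show ?thesis
      by (cases "k = 0") (auto simp: mult.commute insert_absorb)
  qed
  have verts: "pverts (cycle_graph (Suc (Suc k))) = {..Suc k}"
    by (auto simp: cycle_graph_def)
  have arcs: "parcs (cycle_graph (Suc (Suc k))) \<subseteq> pverts (cycle_graph (Suc (Suc k))) \<times> pverts (cycle_graph (Suc (Suc k)))"
    by (auto simp: cycle_graph_def)
  show ?thesis
    using hom_density_eq_nn_integral[OF _ arcs w W]
    unfolding cycle_graph_increasing_arcs prod verts by simp
qed

section \<open>The bound for an arbitrary graphon\<close>

text \<open>Here \<open>c\<close> is the \<open>n\<close>-th root of the trace of the power
  \<open>2 * n\<close>, that is, the squared Schatten norm of order \<open>2 * n\<close>. For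
  \<open>n = 1\<close> the trace only bounds the density from below, hence the inequality for
  \<open>c ^ n\<close>.\<close>

lemma hom_density_cycle_graph_dominates:
  assumes W: "graphon W" and n: "1 \<le> n" "2 * n < m"
  obtains c where "0 \<le> c" "c ^ n \<le> hom_density (cycle_graph (2 * n)) W"
    "hom_density (cycle_graph m) W \<in> {0..1}" "(hom_density (cycle_graph m) W)\<^sup>2 \<le> c ^ m"
proof -
  let ?U = "unit_interval_measure"
  from graphon_borel_version[OF W] obtain v where v: "symmetric_unit_kernel v"
    and Wv: "AE p in ?U \<Otimes>\<^sub>M ?U. W p = v (fst p) (snd p)" .
  define w where "w x y = ennreal (v x y)" for x y
  have w1: "w x y \<le> 1" for x y
    using v unfolding symmetric_unit_kernel_def w_def by (simp add: ennreal_le_1)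
  have [measurable]: "case_prod w \<in> borel_measurable (?U \<Otimes>\<^sub>M ?U)"
    using v unfolding symmetric_unit_kernel_def w_def by (auto simp: case_prod_unfold)
  interpret symmetric_kernel ?U w
    using v by unfold_locales (auto simp: symmetric_unit_kernel_def w_def)
  note space = eq_refl[OF emeasure_unit_interval_measure]
  have dens: "hom_density (cycle_graph (Suc (Suc k))) W
      = enn2real (\<integral>\<^sup>+x. \<integral>\<^sup>+y. kernel_power ?U w k x y * (if k = 0 then 1 else w x y) \<partial>?U \<partial>?U)" for k
    unfolding hom_density_cycle_graph[OF v Wv] w_def[symmetric]
    by (subst nn_integral_walk[of "\<lambda>x y. if k = 0 then 1 else w x y"]) auto
  define p where "p k = kernel_pairing ?U w 0 k" for k
  \<comment> \<open>The shift makes \<open>a l\<close> the trace of the \<open>l\<close>-th power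
    for \<open>l \<ge> 2\<close>. Truncated subtraction gives \<open>a 0 = a 1 = a 2\<close>, but
    \<open>cs\<close> and \<open>submult\<close> only involve indices from 2 on.\<close>
  define a where "a l = enn2real (p (l - 2))" for l
  have p1: "p k \<le> 1" for k
    unfolding p_def kernel_pairing_def using kernel_power_le_1[of w, OF w1 space]
    by (intro nn_integral_square_le_1 space) (metis mult_mono mult_1 zero_le)
  then have pfin: "p k < top" for k
    by (rule le_less_trans) simp
  have dens_eq: "hom_density (cycle_graph (Suc (Suc k))) W = a (Suc (Suc k))" if "k \<noteq> 0" for k
    unfolding dens a_def p_def kernel_pairing_def using that by (simp add: mult.commute)
  have dens_ge: "a (Suc (Suc k)) \<le> hom_density (cycle_graph (Suc (Suc k))) W" for k
  \<comment> \<open>For the single edge, the density \<open>\<integral>w\<close> is only bounded below by the squared Hilbert-Schmidt norm \<open>\<integral>w\<^sup>2\<close>.\<close>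
  proof (cases "k = 0")
    case True
    have "p 0 \<le> (\<integral>\<^sup>+x. \<integral>\<^sup>+y. w x y \<partial>?U \<partial>?U)"
      unfolding p_def kernel_pairing_def kernel_power.simps
      by (intro nn_integral_mono) (metis w1 mult_left_mono mult_1_right zero_le)
    moreover have "(\<integral>\<^sup>+x. \<integral>\<^sup>+y. w x y \<partial>?U \<partial>?U) < top"
      by (rule le_less_trans[OF nn_integral_square_le_1[OF w1 space]]) simp
    ultimately show ?thesis
      unfolding dens a_def True by (simp add: enn2real_mono)
  qed (simp add: dens_eq)
  have pair: "p (j + k) = kernel_pairing ?U w j k" for j k
    unfolding p_def by (rule kernel_pairing_eq[symmetric])
  have cs: "(a (j + k))\<^sup>2 \<le> a (2 * j) * a (2 * k)" if jk: "1 \<le> j" "1 \<le> k" for j k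
  proof -
    obtain j' k' where "j = Suc j'" "k = Suc k'" using that[of "j - 1" "k - 1"] jk by simp
    moreover have "(p (j' + k'))\<^sup>2 \<le> p (j' + j') * p (k' + k')"
      unfolding pair by (rule kernel_pairing_Cauchy_Schwarz)
    then have "enn2real (p (j' + k') * p (j' + k')) \<le> enn2real (p (j' + j') * p (k' + k'))"
      using pfin by (intro enn2real_mono) (auto simp: power2_eq_square ennreal_mult_less_top)
    ultimately show ?thesis
      unfolding a_def by (simp add: enn2real_mult power2_eq_square mult_2)
  qed
  have submult: "a (2 * (j + k)) \<le> a (2 * j) * a (2 * k)" if jk: "1 \<le> j" "1 \<le> k" for j k
  proof -
    obtain j' k' where "j = Suc j'" "k = Suc k'" using that[of "j - 1" "k - 1"] jk by simp
    moreover have "p (Suc (j' + k') + Suc (j' + k')) \<le> p (j' + j') * p (k' + k')"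
      unfolding pair by (rule kernel_pairing_submult)
    then have "enn2real (p (Suc (j' + k') + Suc (j' + k'))) \<le> enn2real (p (j' + j') * p (k' + k'))"
      using pfin by (intro enn2real_mono) (auto simp: ennreal_mult_less_top)
    ultimately show ?thesis
      unfolding a_def by (simp add: enn2real_mult mult_2 add_ac)
  qed
  have a0: "0 \<le> a l" for l unfolding a_def by simp
  define c where "c = root n (a (2 * n))"
  have c: "0 \<le> c" "c ^ n = a (2 * n)"
    using a0 n unfolding c_def by (auto intro: real_root_pow_pos2)
  obtain i where i: "2 * n = Suc (Suc i)" using that[of "2 * n - 2"] n by simp
  obtain k where k: "m = Suc (Suc k)" "k \<noteq> 0"
    using that[of "m - 2"] n by simp
  show ?thesis
  proof
    show "c ^ n \<le> hom_density (cycle_graph (2 * n)) W"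
      using dens_ge[of i] c unfolding i by simp
    show "hom_density (cycle_graph m) W \<in> {0..1}"
      using enn2real_mono[OF p1[of k]] unfolding k dens_eq[OF k(2)] a_def by simp
    show "(hom_density (cycle_graph m) W)\<^sup>2 \<le> c ^ m"
      using log_convex_bound[of a c n m, OF a0 cs submult c n(1)] n unfolding k dens_eq[OF k(2)] by simp
  qed (rule c)
qed

section \<open>The extremal graphon\<close>

text \<open>Every vertex lies on an edge, so the product over edges is 1 exactly when all
  \<open>l\<close> coordinates lie in \<open>{0..1/2}\<close>; these are independent events of
  measure 1/2.\<close>

lemma hom_density_clique_graphon:
  assumes "2 \<le> l"
  defines "W \<equiv> indicator ({0..1/2} \<times> {0..1/2}) :: real \<times> real \<Rightarrow> real"
  shows "graphon W" and "hom_density (cycle_graph l) W = (1/2) ^ l"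
proof -
  let ?U = unit_interval_measure
  have [measurable]: "{0..1/2} \<in> sets ?U"
    by (subst sets_restrict_space_iff) auto
  have "W \<in> borel_measurable borel"
    unfolding W_def by (intro borel_measurable_indicator borel_closed closed_Times) auto
  then have "W \<in> borel_measurable lebesgue"
    by (intro measurable_completion) simp
  then have "W \<in> borel_measurable (lebesgue_on ({0..1} \<times> {0..1}))"
    by (rule measurable_restrict_space1)
  then show "graphon W"
    unfolding graphon_def W_def by (auto simp: indicator_def)
  obtain k where k: "l = Suc (Suc k)" using that[of "l - 2"] assms(1) by simp
  define w :: "real \<Rightarrow> real \<Rightarrow> real" where "w x y = indicator {0..1/2} x * indicator {0..1/2} y" for x y
  have "case_prod w \<in> borel_measurable (?U \<Otimes>\<^sub>M ?U)"
    unfolding w_def by measurable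
  then have w: "symmetric_unit_kernel w"
    unfolding symmetric_unit_kernel_def by (auto simp: w_def indicator_def)
  have Ww: "AE p in ?U \<Otimes>\<^sub>M ?U. W p = w (fst p) (snd p)"
    unfolding W_def w_def by (auto simp: indicator_def mem_Times_iff)
  let ?i = "indicator {0..1/2} :: real \<Rightarrow> ennreal"
  have prod: "(\<Prod>i\<le>k. ennreal (w (x i) (x (Suc i)))) * (if k = 0 then 1 else ennreal (w (x 0) (x (Suc k))))
      = (\<Prod>i\<le>Suc k. ?i (x i))" for x
  proof (cases "\<forall>i\<le>Suc k. x i \<in> {0..1/2}")
    case True
    then show ?thesis unfolding w_def by (simp del: prod.atMost_Suc)
  next
    case False
    then obtain i where i: "i \<le> Suc k" "x i \<notin> {0..1/2}" by blast
    \<comment> \<open>A path edge at the vertex \<open>i\<close>: the edge starting there, or for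
      the last vertex \<open>Suc k\<close> the edge ending there.\<close>
    define j where "j = min i k"
    have "j \<le> k" "w (x j) (x (Suc j)) = 0"
      using i unfolding j_def w_def by (cases "i = Suc k"; force simp: min_def)+
    then have "(\<Prod>i\<le>k. ennreal (w (x i) (x (Suc i)))) = 0"
      by (intro prod_zero bexI[of _ j]) auto
    moreover have "(\<Prod>i\<le>Suc k. ?i (x i)) = 0"
      using i by (intro prod_zero bexI[of _ i]) auto
    ultimately show ?thesis by (simp only: mult_zero_left)
  qed
  have "emeasure ?U {0..1/2} = ennreal (1/2)"
    by (subst emeasure_restrict_space) auto
  then have "(\<integral>\<^sup>+x. (\<Prod>i\<le>Suc k. ?i (x i)) \<partial>Pi\<^sub>M {..Suc k} (\<lambda>_. ?U)) = ennreal (1/2) ^ l"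
    by (subst unit_cube.product_nn_integral_prod) (auto simp: k simp del: prod.atMost_Suc)
  also have "\<dots> = ennreal ((1/2) ^ l)"
    by (rule ennreal_power) simp
  finally have int: "(\<integral>\<^sup>+x. (\<Prod>i\<le>Suc k. ?i (x i)) \<partial>Pi\<^sub>M {..Suc k} (\<lambda>_. ?U)) = ennreal ((1/2) ^ l)" .
  have "hom_density (cycle_graph l) W = enn2real (ennreal ((1/2) ^ l))"
    unfolding int[symmetric] using hom_density_cycle_graph[OF w Ww] by (simp only: k prod)
  then show "hom_density (cycle_graph l) W = (1/2) ^ l"
    by (simp only: enn2real_ennreal zero_le_power zero_le_divide_1_iff zero_le_numeral)
qed

theorem proposition4p3:
  fixes m n :: nat
  assumes "0 < m" and "0 < n" and "m > 2 * n"
  shows "density_domination_exponent (cycle_graph m) (cycle_graph (2 * n))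
           = ennreal (2 * real n / real m)"
  unfolding density_domination_exponent_def
proof (rule antisym)
  let ?t = "\<lambda>l W. hom_density (cycle_graph l) W"
  let ?q = "\<lambda>W. if ?t (2 * n) W = 0 then \<infinity> else ennreal (ln (?t (2 * n) W) / ln (?t m W))"
  show "(SUP W \<in> {W. graphon W \<and> ?t m W \<noteq> 0 \<and> ?t m W \<noteq> 1}. ?q W) \<le> ennreal (2 * real n / real m)"
  proof (rule SUP_least)
    fix W assume "W \<in> {W. graphon W \<and> ?t m W \<noteq> 0 \<and> ?t m W \<noteq> 1}"
    then have W: "graphon W" "?t m W \<noteq> 0" "?t m W \<noteq> 1" by auto
    obtain c where c: "0 \<le> c" "c ^ n \<le> ?t (2 * n) W" "?t m W \<in> {0..1}" "(?t m W)\<^sup>2 \<le> c ^ m"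
      using hom_density_cycle_graph_dominates[OF W(1), of n m] assms by auto
    have "c \<noteq> 0" using c(4) W(2) assms(1) by (auto simp: power_0_left)
    with c(1) have c0: "0 < c" by simp
    have tm: "0 < ?t m W" "?t m W < 1" using c(3) W by auto
    have t2n: "0 < ?t (2 * n) W" using c0 c(2) by (meson less_le_trans zero_less_power)
    have "ln ((?t m W)\<^sup>2) \<le> ln (c ^ m)"
      using c(4) tm c0 by (subst ln_le_cancel_iff) auto
    then have "2 * ln (?t m W) \<le> real m * ln c"
      using tm c0 by (simp add: ln_realpow)
    moreover have "ln (c ^ n) \<le> ln (?t (2 * n) W)"
      using c(2) t2n c0 by (subst ln_le_cancel_iff) auto
    then have "real n * ln c \<le> ln (?t (2 * n) W)"
      using c0 by (simp add: ln_realpow)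
    \<comment> \<open>Scaling the two bounds by \<open>n\<close> and \<open>m\<close> produces the
      common middle term \<open>n * m * ln c\<close>, which cancels.\<close>
    ultimately have "2 * real n * ln (?t m W) \<le> real m * ln (?t (2 * n) W)"
      using mult_left_mono[of "2 * ln (?t m W)" "real m * ln c" "real n"]
        mult_left_mono[of "real n * ln c" "ln (?t (2 * n) W)" "real m"]
      by (simp add: mult_ac)
    moreover have "ln (?t m W) < 0" using tm by simp
    \<comment> \<open>Dividing by the negative \<open>ln (?t m W)\<close> reverses the
      inequality.\<close>
    ultimately have "ln (?t (2 * n) W) / ln (?t m W) \<le> 2 * real n / real m"
      using assms(1) by (simp add: neg_divide_le_eq field_simps)
    then show "?q W \<le> ennreal (2 * real n / real m)"
      using t2n by (simp add: ennreal_leI)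
  qed
  let ?W = "indicator ({0..1/2} \<times> {0..1/2}) :: real \<times> real \<Rightarrow> real"
  have t: "?t l ?W = (1/2) ^ l" if "2 \<le> l" for l
    by (rule hom_density_clique_graphon(2)[OF that])
  have "graphon ?W" by (rule hom_density_clique_graphon(1)[of 2]) simp
  moreover have "?t m ?W \<noteq> 0" "?t m ?W \<noteq> 1"
    using assms t[of m] power_strict_decreasing[of 0 m "1/2::real"] by auto
  moreover have "ln (?t (2 * n) ?W) / ln (?t m ?W) = 2 * real n / real m"
    using assms t[of m] t[of "2 * n"] by (simp add: ln_realpow ln_div)
  then have "ennreal (2 * real n / real m) = ?q ?W"
    using assms t[of "2 * n"] by simp
  ultimately show "ennreal (2 * real n / real m) \<le> (SUP W \<in> {W. graphon W \<and> ?t m W \<noteq> 0 \<and> ?t m W \<noteq> 1}. ?q W)"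
    by (intro SUP_upper2[of ?W]) auto
qed

end
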